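(* Let $(M,J,g)$ be an almost Norden manifold with associated metric $\widetilde g(X,Y)=g(X,JY)$, and let $\nabla$ be a linear connection on $M$. Then: (i) the conjugate connections of $\nabla$ relative to $g$ and to $J$ coincide if and only if $\nabla\widetilde g=0$; (ii) the conjugate connections of $\nabla$ relative to $\widetilde g$ and to $J$ coincide if and only if $\nabla g=0$.
   Context: An almost Norden manifold $(M,J,g)$ is a differentiable $2n$-dimensional manifold $M$ with an almost complex structure $J$ ($J^2=-\mathrm{id}$) and a pseudo-Riemannian metric $g$ such that $g(JX,JY)=-g(X,Y)$. Then $\widetilde g(X,Y)=g(X,JY)$ is also a (symmetric, nondegenerate) pseudo-Riemannian metric. The conjugate connection of a linear connection $\nabla$ relative to a pseudo-Riemannian metric $h$ is the linear connection $\nabla^\ast$ determined by $X h(Y,Z)=h(\nabla_XY,Z)+h(Y,\nabla^\ast_XZ)$. The conjugate connection of $\nabla$ relative to $J$ (complex conjugate connection) is the linear connection $\nabla^\ast_XY=-J\nabla_X(JY)=\nabla_XY-J(\nabla_XJ)Y$. *)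

theory Defs
  imports "HOL-Analysis.Analysis" "HOL-Library.FuncSet"
begin

section \<open>Smooth manifolds\<close>

text \<open>Only used for open \<open>S\<close>, where Frechet derivatives are unique.\<close>

fun Ck_on :: "nat \<Rightarrow> 'e::euclidean_space set \<Rightarrow> ('e \<Rightarrow> 'b::real_normed_vector) \<Rightarrow> bool" where
  "Ck_on 0 S f \<longleftrightarrow> continuous_on S f"
| "Ck_on (Suc k) S f \<longleftrightarrow>
     (\<forall>x\<in>S. f differentiable (at x)) \<and> (\<forall>v. Ck_on k S (\<lambda>x. frechet_derivative f (at x) v))"

definition smooth_on :: "'e::euclidean_space set \<Rightarrow> ('e \<Rightarrow> 'b::real_normed_vector) \<Rightarrow> bool" where
  "smooth_on S f \<longleftrightarrow> (\<forall>k. Ck_on k S f)"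

text \<open>A chart is a pair \<open>(U, \<phi>)\<close>; only the values of \<open>\<phi>\<close> on \<open>U\<close> matter. The underlying
  space of the manifold is a whole Hausdorff, second countable type.\<close>

type_synonym ('a, 'e) chart = "'a set \<times> ('a \<Rightarrow> 'e)"

definition is_chart ::
    "('a::{t2_space, second_countable_topology}, 'e::euclidean_space) chart \<Rightarrow> bool" where
  "is_chart = (\<lambda>(U, \<phi>). open U \<and> open (\<phi> ` U) \<and> (\<exists>\<psi>. homeomorphism U (\<phi> ` U) \<phi> \<psi>))"

definition smooth_atlas ::
    "('a::{t2_space, second_countable_topology}, 'e::euclidean_space) chart set \<Rightarrow> bool" where
  "smooth_atlas A \<longleftrightarrow>
     (\<forall>c\<in>A. is_chart c) \<and> (\<Union>(fst ` A) = UNIV) \<and>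
     (\<forall>(U, \<phi>)\<in>A. \<forall>(V, \<psi>)\<in>A. smooth_on (\<phi> ` (U \<inter> V)) (\<psi> \<circ> inv_into U \<phi>))"

definition smooth_functions ::
    "('a::{t2_space, second_countable_topology}, 'e::euclidean_space) chart set \<Rightarrow> ('a \<Rightarrow> real) set" where
  "smooth_functions A = {f. \<forall>(U, \<phi>)\<in>A. smooth_on (\<phi> ` U) (f \<circ> inv_into U \<phi>)}"

section \<open>Vector fields\<close>

text \<open>Smooth vector fields are the derivations of the real algebra of smooth functions. They are
  extensional (\<open>undefined\<close> on non-smooth functions), so that HOL equality is equality of vector
  fields; the value of \<open>X\<close> at the point \<open>p\<close> is the derivation \<open>\<lambda>f. X f p\<close> at \<open>p\<close>.\<close>

type_synonym 'a vfield = "('a \<Rightarrow> real) \<Rightarrow> 'a \<Rightarrow> real"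

definition vector_fields ::
    "('a::{t2_space, second_countable_topology}, 'e::euclidean_space) chart set \<Rightarrow> 'a vfield set" where
  "vector_fields A = {X \<in> smooth_functions A \<rightarrow>\<^sub>E smooth_functions A.
     (\<forall>f\<in>smooth_functions A. \<forall>h\<in>smooth_functions A.
        X (\<lambda>p. f p + h p) = (\<lambda>p. X f p + X h p) \<and>
        X (\<lambda>p. f p * h p) = (\<lambda>p. X f p * h p + f p * X h p)) \<and>
     (\<forall>c. \<forall>f\<in>smooth_functions A. X (\<lambda>p. c * f p) = (\<lambda>p. c * X f p))}"

definition vf_add ::
    "('a::{t2_space, second_countable_topology}, 'e::euclidean_space) chart set \<Rightarrow>
       'a vfield \<Rightarrow> 'a vfield \<Rightarrow> 'a vfield" where
  "vf_add A X Y = (\<lambda>f\<in>smooth_functions A. \<lambda>p. X f p + Y f p)"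

definition vf_scale ::
    "('a::{t2_space, second_countable_topology}, 'e::euclidean_space) chart set \<Rightarrow>
       ('a \<Rightarrow> real) \<Rightarrow> 'a vfield \<Rightarrow> 'a vfield" where
  "vf_scale A h X = (\<lambda>f\<in>smooth_functions A. \<lambda>p. h p * X f p)"

definition vf_minus ::
    "('a::{t2_space, second_countable_topology}, 'e::euclidean_space) chart set \<Rightarrow>
       'a vfield \<Rightarrow> 'a vfield" where
  "vf_minus A X = vf_scale A (\<lambda>p. -1) X"

section \<open>Tensor fields\<close>

text \<open>Tensor fields are maps on vector fields that are multilinear over the ring of smooth
  functions.\<close>

definition endomorphism_field ::
    "('a::{t2_space, second_countable_topology}, 'e::euclidean_space) chart set \<Rightarrow>
       ('a vfield \<Rightarrow> 'a vfield) \<Rightarrow> bool" where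
  "endomorphism_field A J \<longleftrightarrow>
     J \<in> vector_fields A \<rightarrow> vector_fields A \<and>
     (\<forall>X\<in>vector_fields A. \<forall>Y\<in>vector_fields A. J (vf_add A X Y) = vf_add A (J X) (J Y)) \<and>
     (\<forall>f\<in>smooth_functions A. \<forall>X\<in>vector_fields A. J (vf_scale A f X) = vf_scale A f (J X))"

definition bilinear_form_field ::
    "('a::{t2_space, second_countable_topology}, 'e::euclidean_space) chart set \<Rightarrow>
       ('a vfield \<Rightarrow> 'a vfield \<Rightarrow> 'a \<Rightarrow> real) \<Rightarrow> bool" where
  "bilinear_form_field A h \<longleftrightarrow>
     h \<in> vector_fields A \<rightarrow> vector_fields A \<rightarrow> smooth_functions A \<and>
     (\<forall>X\<in>vector_fields A. \<forall>Y\<in>vector_fields A. \<forall>Z\<in>vector_fields A.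
        h (vf_add A X Y) Z = (\<lambda>p. h X Z p + h Y Z p) \<and>
        h Z (vf_add A X Y) = (\<lambda>p. h Z X p + h Z Y p)) \<and>
     (\<forall>f\<in>smooth_functions A. \<forall>X\<in>vector_fields A. \<forall>Y\<in>vector_fields A.
        h (vf_scale A f X) Y = (\<lambda>p. f p * h X Y p) \<and>
        h X (vf_scale A f Y) = (\<lambda>p. f p * h X Y p))"

text \<open>Nondegeneracy is required on every tangent space: \<open>h X Y p\<close> depends only on the values of
  \<open>X\<close> and \<open>Y\<close> at \<open>p\<close>, and every tangent vector is the value of some vector field.
  Constancy of the signature is not imposed: it holds on each connected component, and the
  Norden condition below forces the signature \<open>(n, n)\<close>.\<close>

definition pseudo_riemannian_metric ::
    "('a::{t2_space, second_countable_topology}, 'e::euclidean_space) chart set \<Rightarrow>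
       ('a vfield \<Rightarrow> 'a vfield \<Rightarrow> 'a \<Rightarrow> real) \<Rightarrow> bool" where
  "pseudo_riemannian_metric A h \<longleftrightarrow>
     bilinear_form_field A h \<and>
     (\<forall>X\<in>vector_fields A. \<forall>Y\<in>vector_fields A. h X Y = h Y X) \<and>
     (\<forall>p. \<forall>X\<in>vector_fields A.
        (\<forall>Y\<in>vector_fields A. h X Y p = 0) \<longrightarrow> (\<forall>f\<in>smooth_functions A. X f p = 0))"

definition almost_complex_structure ::
    "('a::{t2_space, second_countable_topology}, 'e::euclidean_space) chart set \<Rightarrow>
       ('a vfield \<Rightarrow> 'a vfield) \<Rightarrow> bool" where
  "almost_complex_structure A J \<longleftrightarrow>
     endomorphism_field A J \<and> (\<forall>X\<in>vector_fields A. J (J X) = vf_minus A X)"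

definition almost_norden_manifold ::
    "nat \<Rightarrow> ('a::{t2_space, second_countable_topology}, 'e::euclidean_space) chart set \<Rightarrow>
       ('a vfield \<Rightarrow> 'a vfield) \<Rightarrow> ('a vfield \<Rightarrow> 'a vfield \<Rightarrow> 'a \<Rightarrow> real) \<Rightarrow> bool" where
  "almost_norden_manifold n A J g \<longleftrightarrow>
     smooth_atlas A \<and> DIM('e) = 2 * n \<and>
     almost_complex_structure A J \<and> pseudo_riemannian_metric A g \<and>
     (\<forall>X\<in>vector_fields A. \<forall>Y\<in>vector_fields A. g (J X) (J Y) = (\<lambda>p. - g X Y p))"

definition associated_metric ::
    "('a vfield \<Rightarrow> 'a vfield) \<Rightarrow> ('a vfield \<Rightarrow> 'a vfield \<Rightarrow> 'a \<Rightarrow> real) \<Rightarrow>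
       'a vfield \<Rightarrow> 'a vfield \<Rightarrow> 'a \<Rightarrow> real" where
  "associated_metric J g X Y = g X (J Y)"

section \<open>Linear connections\<close>

text \<open>\<open>D X Y\<close> is the covariant derivative of \<open>Y\<close> in the direction \<open>X\<close>. Connections are
  extensional in both arguments.\<close>

definition linear_connection ::
    "('a::{t2_space, second_countable_topology}, 'e::euclidean_space) chart set \<Rightarrow>
       ('a vfield \<Rightarrow> 'a vfield \<Rightarrow> 'a vfield) \<Rightarrow> bool" where
  "linear_connection A D \<longleftrightarrow>
     D \<in> vector_fields A \<rightarrow>\<^sub>E vector_fields A \<rightarrow>\<^sub>E vector_fields A \<and>
     (\<forall>X\<in>vector_fields A. \<forall>Y\<in>vector_fields A. \<forall>Z\<in>vector_fields A.
        D (vf_add A X Y) Z = vf_add A (D X Z) (D Y Z) \<and>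
        D Z (vf_add A X Y) = vf_add A (D Z X) (D Z Y)) \<and>
     (\<forall>f\<in>smooth_functions A. \<forall>X\<in>vector_fields A. \<forall>Y\<in>vector_fields A.
        D (vf_scale A f X) Y = vf_scale A f (D X Y) \<and>
        D X (vf_scale A f Y) = vf_add A (vf_scale A (X f) Y) (vf_scale A f (D X Y)))"

definition covariant_derivative_form ::
    "('a vfield \<Rightarrow> 'a vfield \<Rightarrow> 'a vfield) \<Rightarrow> ('a vfield \<Rightarrow> 'a vfield \<Rightarrow> 'a \<Rightarrow> real) \<Rightarrow>
       'a vfield \<Rightarrow> 'a vfield \<Rightarrow> 'a vfield \<Rightarrow> 'a \<Rightarrow> real" where
  "covariant_derivative_form D h X Y Z = (\<lambda>p. X (h Y Z) p - h (D X Y) Z p - h Y (D X Z) p)"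

definition parallel_form ::
    "('a::{t2_space, second_countable_topology}, 'e::euclidean_space) chart set \<Rightarrow>
       ('a vfield \<Rightarrow> 'a vfield \<Rightarrow> 'a vfield) \<Rightarrow> ('a vfield \<Rightarrow> 'a vfield \<Rightarrow> 'a \<Rightarrow> real) \<Rightarrow> bool" where
  "parallel_form A D h \<longleftrightarrow>
     (\<forall>X\<in>vector_fields A. \<forall>Y\<in>vector_fields A. \<forall>Z\<in>vector_fields A.
        covariant_derivative_form D h X Y Z = (\<lambda>p. 0))"

text \<open>\<open>D'\<close> is the conjugate connection of \<open>D\<close> relative to the metric \<open>h\<close>. For a metric \<open>h\<close> this
  determines \<open>D'\<close>.\<close>

definition metric_conjugate ::
    "('a::{t2_space, second_countable_topology}, 'e::euclidean_space) chart set \<Rightarrow>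
       ('a vfield \<Rightarrow> 'a vfield \<Rightarrow> 'a \<Rightarrow> real) \<Rightarrow>
       ('a vfield \<Rightarrow> 'a vfield \<Rightarrow> 'a vfield) \<Rightarrow> ('a vfield \<Rightarrow> 'a vfield \<Rightarrow> 'a vfield) \<Rightarrow> bool" where
  "metric_conjugate A h D D' \<longleftrightarrow>
     linear_connection A D' \<and>
     (\<forall>X\<in>vector_fields A. \<forall>Y\<in>vector_fields A. \<forall>Z\<in>vector_fields A.
        X (h Y Z) = (\<lambda>p. h (D X Y) Z p + h Y (D' X Z) p))"

definition complex_conjugate ::
    "('a::{t2_space, second_countable_topology}, 'e::euclidean_space) chart set \<Rightarrow>
       ('a vfield \<Rightarrow> 'a vfield) \<Rightarrow>
       ('a vfield \<Rightarrow> 'a vfield \<Rightarrow> 'a vfield) \<Rightarrow> 'a vfield \<Rightarrow> 'a vfield \<Rightarrow> 'a vfield" where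
  "complex_conjugate A J D =
     (\<lambda>X\<in>vector_fields A. \<lambda>Y\<in>vector_fields A. vf_minus A (J (D X (J Y))))"

end

theory Submission
  imports Defs
begin

text \<open>Substituting the defining equation of the conjugate connection \<open>D'\<close> into the covariant
  derivative turns parallelism into an equality of vector fields tested against the
  nondegenerate form \<open>g\<close>: \<open>\<nabla>g\<^sub>J = 0\<close> (with \<open>g\<^sub>J = g(\<sqdot>, J\<sqdot>)\<close>) means \<open>D'\<^sub>X (J Z) = J (D\<^sub>X Z)\<close> when
  \<open>D'\<close> is conjugate relative to \<open>g\<close>, and \<open>\<nabla>g = 0\<close> means \<open>J (D'\<^sub>X Z) = D\<^sub>X (J Z)\<close> when \<open>D'\<close> is
  conjugate relative to \<open>g\<^sub>J\<close>. As \<open>J\<^sup>2 = -1\<close>, both say that \<open>D'\<^sub>X Z = - J (D\<^sub>X (J Z))\<close>.\<close>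

section \<open>Smooth functions\<close>

lemma Ck_on_const: "Ck_on k S (\<lambda>x. c)"
  by (induction k arbitrary: c) auto

text \<open>As \<open>S\<close> is open, equality on \<open>S\<close> is equality near each of its
  points, so the derivatives agree on \<open>S\<close> and the induction hypothesis applies to them.
  This permits rewriting \<open>frechet_derivative\<close> by rules that are justified only at
  points of \<open>S\<close>.\<close>

lemma Ck_on_cong:
  assumes "open S" "\<And>x. x \<in> S \<Longrightarrow> f x = g x" "Ck_on k S f"
  shows "Ck_on k S g"
  using assms
proof (induction k arbitrary: f g)
  case 0
  then show ?case by (simp cong: continuous_on_cong)
next
  case (Suc k)
  have der: "(g has_derivative frechet_derivative f (at x)) (at x)" if "x \<in> S" for x
  proof (rule has_derivative_transform_within_open)
    show "(f has_derivative frechet_derivative f (at x)) (at x)"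
      using Suc.prems that by (simp add: frechet_derivative_works[symmetric])
  qed (use Suc.prems that in auto)
  have "frechet_derivative g (at x) = frechet_derivative f (at x)" if "x \<in> S" for x
    using frechet_derivative_at[OF der[OF that]] by simp
  then have "Ck_on k S (\<lambda>x. frechet_derivative g (at x) v)" for v
    using Suc.prems by - (rule Suc.IH[of "\<lambda>x. frechet_derivative f (at x) v"], auto)
  then show ?case
    using der by (auto simp: differentiable_def)
qed

text \<open>Needed for products: the Leibniz rule leaves one factor undifferentiated, and that
  factor must be fed to the induction hypothesis at the lower order.\<close>

lemma Ck_on_Suc_imp: "Ck_on (Suc k) S f \<Longrightarrow> Ck_on k S f"
proof (induction k arbitrary: f)
  case 0
  then show ?case
    by (auto intro!: continuous_at_imp_continuous_on differentiable_imp_continuous_within)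
next
  case (Suc k)
  from Suc.prems have "Ck_on (Suc k) S (\<lambda>x. frechet_derivative f (at x) v)" for v
    by (subst (asm) Ck_on.simps) blast
  then have "Ck_on k S (\<lambda>x. frechet_derivative f (at x) v)" for v
    by (rule Suc.IH)
  moreover have "\<forall>x\<in>S. f differentiable (at x)"
    using Suc.prems by simp
  ultimately show ?case by simp
qed

lemma Ck_on_add:
  assumes "open S" "Ck_on k S f" "Ck_on k S g"
  shows "Ck_on k S (\<lambda>x. f x + g x)"
  using assms(2,3)
proof (induction k arbitrary: f g)
  case 0
  then show ?case by (simp add: continuous_on_add)
next
  case (Suc k)
  have "Ck_on k S (\<lambda>x. frechet_derivative (\<lambda>x. f x + g x) (at x) v)" for v
  proof (rule Ck_on_cong[OF \<open>open S\<close>])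
    show "Ck_on k S (\<lambda>x. frechet_derivative f (at x) v + frechet_derivative g (at x) v)"
      using Suc by simp
  next
    fix x assume "x \<in> S"
    then have "((\<lambda>x. f x + g x) has_derivative
        (\<lambda>v. frechet_derivative f (at x) v + frechet_derivative g (at x) v)) (at x)"
      using Suc.prems by (intro has_derivative_add) (auto simp: frechet_derivative_works[symmetric])
    from frechet_derivative_at[OF this]
    show "frechet_derivative f (at x) v + frechet_derivative g (at x) v =
        frechet_derivative (\<lambda>x. f x + g x) (at x) v"
      by metis
  qed
  then show ?case
    using Suc.prems by (auto intro: differentiable_add)
qed

lemma Ck_on_mult:
  fixes f g :: "'e::euclidean_space \<Rightarrow> 'b::real_normed_algebra"
  assumes "open S" "Ck_on k S f" "Ck_on k S g"
  shows "Ck_on k S (\<lambda>x. f x * g x)"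
  using assms(2,3)
proof (induction k arbitrary: f g)
  case 0
  then show ?case by (simp add: continuous_on_mult)
next
  case (Suc k)
  have "Ck_on k S (\<lambda>x. frechet_derivative (\<lambda>x. f x * g x) (at x) v)" for v
  proof (rule Ck_on_cong[OF \<open>open S\<close>])
    show "Ck_on k S (\<lambda>x. f x * frechet_derivative g (at x) v + frechet_derivative f (at x) v * g x)"
      using Suc.prems Suc.prems[THEN Ck_on_Suc_imp]
      by (intro Ck_on_add[OF \<open>open S\<close>] Suc.IH) auto
  next
    fix x assume "x \<in> S"
    then have "((\<lambda>x. f x * g x) has_derivative
        (\<lambda>v. f x * frechet_derivative g (at x) v + frechet_derivative f (at x) v * g x)) (at x)"
      using Suc.prems by (intro has_derivative_mult) (auto simp: frechet_derivative_works[symmetric])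
    from frechet_derivative_at[OF this]
    show "f x * frechet_derivative g (at x) v + frechet_derivative f (at x) v * g x =
        frechet_derivative (\<lambda>x. f x * g x) (at x) v"
      by metis
  qed
  then show ?case
    using Suc.prems by (auto intro: differentiable_mult)
qed

lemma smooth_functions_const: "(\<lambda>p. c) \<in> smooth_functions A"
  by (auto simp: smooth_functions_def smooth_on_def comp_def intro: Ck_on_const)

lemma smooth_atlas_open:
  assumes "smooth_atlas A" "(U, \<phi>) \<in> A"
  shows "open (\<phi> ` U)"
  using assms by (force simp: smooth_atlas_def is_chart_def)

lemma smooth_functions_add:
  assumes "smooth_atlas A" "f \<in> smooth_functions A" "h \<in> smooth_functions A"
  shows "(\<lambda>p. f p + h p) \<in> smooth_functions A"
  using assms(2,3)
  by (fastforce simp: smooth_functions_def smooth_on_def comp_def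
      intro: Ck_on_add[OF smooth_atlas_open[OF assms(1)]])

lemma smooth_functions_mult:
  assumes "smooth_atlas A" "f \<in> smooth_functions A" "h \<in> smooth_functions A"
  shows "(\<lambda>p. f p * h p) \<in> smooth_functions A"
  using assms(2,3)
  by (fastforce simp: smooth_functions_def smooth_on_def comp_def
      intro: Ck_on_mult[OF smooth_atlas_open[OF assms(1)]])

section \<open>Vector fields and connections\<close>

lemma vector_fields_add:
  assumes A: "smooth_atlas A" and X: "X \<in> vector_fields A" and Y: "Y \<in> vector_fields A"
  shows "vf_add A X Y \<in> vector_fields A"
proof -
  \<comment> \<open>\<open>vf_add\<close> is restricted to smooth functions, so homogeneity can be
    read off only once the scaled argument is known to be smooth.\<close>
  have "(\<lambda>p. c * f p) \<in> smooth_functions A" if "f \<in> smooth_functions A" for c f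
    using smooth_functions_mult[OF A smooth_functions_const that] .
  then show ?thesis
    using X Y smooth_functions_add[OF A] smooth_functions_mult[OF A]
    by (auto simp: vector_fields_def vf_add_def algebra_simps PiE_iff)
qed

lemma vf_minus_apply: "f \<in> smooth_functions A \<Longrightarrow> vf_minus A X f p = - X f p"
  by (simp add: vf_minus_def vf_scale_def)

lemma vf_minus_undefined: "f \<notin> smooth_functions A \<Longrightarrow> vf_minus A X f = undefined"
  by (simp add: vf_minus_def vf_scale_def)

lemma vector_fields_eqI:
  assumes "X \<in> vector_fields A" "Y \<in> vector_fields A"
    and "\<And>f p. f \<in> smooth_functions A \<Longrightarrow> X f p = Y f p"
  shows "X = Y"
  using assms by (intro PiE_ext[where k = "smooth_functions A" and s = "\<lambda>_. smooth_functions A"])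
    (auto simp: vector_fields_def)

lemma vf_minus_minus:
  assumes "X \<in> vector_fields A"
  shows "vf_minus A (vf_minus A X) = X"
proof
  fix f
  show "vf_minus A (vf_minus A X) f = X f"
    \<comment> \<open>Outside the smooth functions both sides are \<open>undefined\<close>, since
      \<open>X\<close> is extensional.\<close>
    using assms by (cases "f \<in> smooth_functions A")
      (auto simp: vf_minus_apply vf_minus_undefined vector_fields_def)
qed

lemma vector_field_const:
  assumes "X \<in> vector_fields A"
  shows "X (\<lambda>p. c) = (\<lambda>p. 0)"
proof -
  have leibniz: "X (\<lambda>p. f p * h p) = (\<lambda>p. X f p * h p + f p * X h p)"
    and scale: "X (\<lambda>p. c * f p) = (\<lambda>p. c * X f p)"
    if "f \<in> smooth_functions A" "h \<in> smooth_functions A" for f h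
    using assms that unfolding vector_fields_def by blast+
  \<comment> \<open>Leibniz on 1 = 1 * 1 gives X1 = 2 X1; other constants follow by
    homogeneity.\<close>
  have "X (\<lambda>p. 1) p = 0" for p
    using leibniz[of "\<lambda>p. 1" "\<lambda>p. 1"] smooth_functions_const[of 1 A]
    by (auto dest: fun_cong[where x = p])
  then show ?thesis
    using scale[of "\<lambda>p. 1" "\<lambda>p. 1"] smooth_functions_const[of 1 A] by simp
qed

lemma linear_connection_closed:
  assumes "linear_connection A D" "X \<in> vector_fields A" "Y \<in> vector_fields A"
  shows "D X Y \<in> vector_fields A"
  using assms unfolding linear_connection_def by blast

text \<open>Negation is scaling by the constant -1, whose derivative along \<open>X\<close>
  vanishes, so the Leibniz rule leaves only the tensorial term.\<close>

lemma linear_connection_minus: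
  assumes D: "linear_connection A D" and X: "X \<in> vector_fields A" and Y: "Y \<in> vector_fields A"
  shows "D X (vf_minus A Y) = vf_minus A (D X Y)"
proof -
  have "D X (vf_minus A Y) =
      vf_add A (vf_scale A (X (\<lambda>p. -1)) Y) (vf_scale A (\<lambda>p. -1) (D X Y))"
    using D X Y smooth_functions_const[of "-1" A]
    unfolding linear_connection_def vf_minus_def by blast
  also have "\<dots> = vf_minus A (D X Y)"
    by (auto simp: vector_field_const[OF X] vf_add_def vf_scale_def vf_minus_def fun_eq_iff)
  finally show ?thesis .
qed

text \<open>Both sides are extensional in both arguments, so they can differ only on vector
  fields.\<close>

lemma linear_connection_eq_complex_conjugate_iff:
  assumes "linear_connection A D'"
  shows "D' = complex_conjugate A J D \<longleftrightarrow>
    (\<forall>X\<in>vector_fields A. \<forall>Y\<in>vector_fields A. D' X Y = vf_minus A (J (D X (J Y))))"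
    (is "?L \<longleftrightarrow> ?R")
proof
  assume ?R
  have ext: "D' \<in> vector_fields A \<rightarrow>\<^sub>E vector_fields A \<rightarrow>\<^sub>E vector_fields A"
    using assms by (simp add: linear_connection_def)
  have "D' X Y = complex_conjugate A J D X Y" for X Y
  proof (cases "X \<in> vector_fields A")
    case True
    with ext have "D' X \<in> vector_fields A \<rightarrow>\<^sub>E vector_fields A" by blast
    then show ?thesis
      using True \<open>?R\<close> PiE_arb[of "D' X"]
      by (cases "Y \<in> vector_fields A") (auto simp: complex_conjugate_def)
  qed (use PiE_arb[OF ext] in \<open>simp add: complex_conjugate_def\<close>)
  then show ?L by blast
qed (simp add: complex_conjugate_def)

section \<open>Metrics: conjugacy, parallelism and nondegeneracy\<close>

lemma metric_conjugateD:
  assumes "metric_conjugate A h D D'"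
    "X \<in> vector_fields A" "Y \<in> vector_fields A" "Z \<in> vector_fields A"
  shows "X (h Y Z) = (\<lambda>p. h (D X Y) Z p + h Y (D' X Z) p)"
  using assms unfolding metric_conjugate_def by blast

text \<open>In this form parallelism differs from conjugacy only in the last summand, so comparing
  the two cancels the term with \<open>D X Y\<close>.\<close>

lemma parallel_form_iff:
  "parallel_form A D h \<longleftrightarrow>
     (\<forall>X\<in>vector_fields A. \<forall>Y\<in>vector_fields A. \<forall>Z\<in>vector_fields A.
        X (h Y Z) = (\<lambda>p. h (D X Y) Z p + h Y (D X Z) p))"
  by (simp add: parallel_form_def covariant_derivative_form_def fun_eq_iff algebra_simps)

lemma bilinear_form_minus:
  assumes "bilinear_form_field A h" "X \<in> vector_fields A" "Y \<in> vector_fields A"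
  shows "h (vf_minus A X) Y = (\<lambda>p. - h X Y p)"
proof -
  have "h (vf_scale A (\<lambda>p. -1) X) Y = (\<lambda>p. -1 * h X Y p)"
    using assms smooth_functions_const[of "-1" A] unfolding bilinear_form_field_def by blast
  then show ?thesis by (simp add: vf_minus_def)
qed

text \<open>The negative is obtained as \<open>J (J X)\<close>, so closure is inherited from
  \<open>J\<close>.\<close>

lemma vector_fields_minus:
  assumes "almost_complex_structure A J" "X \<in> vector_fields A"
  shows "vf_minus A X \<in> vector_fields A"
proof -
  have "J (J X) \<in> vector_fields A"
    using assms unfolding almost_complex_structure_def endomorphism_field_def by blast
  then show ?thesis
    using assms by (simp add: almost_complex_structure_def)
qed

text \<open>Nondegeneracy at each point is applied to the difference \<open>W\<close> of
  \<open>U\<close> and \<open>V\<close>; symmetry carries the hypothesis from the second slot to the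
  first.\<close>

lemma metric_eqI:
  assumes A: "smooth_atlas A" and h: "pseudo_riemannian_metric A h"
    and U: "U \<in> vector_fields A" and V: "V \<in> vector_fields A" "vf_minus A V \<in> vector_fields A"
    and eq: "\<And>Y. Y \<in> vector_fields A \<Longrightarrow> h Y U = h Y V"
  shows "U = V"
proof (rule vector_fields_eqI[OF U V(1)])
  fix f p assume f: "f \<in> smooth_functions A"
  define W where "W = vf_add A U (vf_minus A V)"
  have W: "W \<in> vector_fields A"
    unfolding W_def by (rule vector_fields_add[OF A U V(2)])
  have bil: "bilinear_form_field A h"
    and sym: "\<And>X Y. \<lbrakk>X \<in> vector_fields A; Y \<in> vector_fields A\<rbrakk> \<Longrightarrow> h X Y = h Y X"
    using h by (auto simp: pseudo_riemannian_metric_def)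
  have "h W Y p = 0" if Y: "Y \<in> vector_fields A" for Y
  proof -
    have "h W Y = (\<lambda>p. h U Y p + h (vf_minus A V) Y p)"
      using bil U V Y unfolding W_def bilinear_form_field_def by blast
    then show ?thesis
      using bilinear_form_minus[OF bil V(1) Y] eq[OF Y] sym[OF Y U] sym[OF Y V(1)] by simp
  qed
  then have "W f p = 0"
    using h W f unfolding pseudo_riemannian_metric_def by blast
  then show "U f p = V f p"
    using f by (simp add: W_def vf_add_def vf_minus_apply)
qed

theorem proposition2p2:
  fixes A :: "('a::{t2_space, second_countable_topology}, 'e::euclidean_space) chart set"
    and n :: nat
    and J :: "'a vfield \<Rightarrow> 'a vfield"
    and g :: "'a vfield \<Rightarrow> 'a vfield \<Rightarrow> 'a \<Rightarrow> real"
    and D :: "'a vfield \<Rightarrow> 'a vfield \<Rightarrow> 'a vfield"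
  assumes "almost_norden_manifold n A J g"
    and "linear_connection A D"
  shows "(\<forall>Dg. metric_conjugate A g D Dg \<longrightarrow>
            (Dg = complex_conjugate A J D \<longleftrightarrow> parallel_form A D (associated_metric J g))) \<and>
         (\<forall>Dgt. metric_conjugate A (associated_metric J g) D Dgt \<longrightarrow>
            (Dgt = complex_conjugate A J D \<longleftrightarrow> parallel_form A D g))"
proof -
  let ?V = "vector_fields A"
  have A: "smooth_atlas A" and J: "almost_complex_structure A J"
    and g: "pseudo_riemannian_metric A g"
    using assms(1) by (auto simp: almost_norden_manifold_def)
  have JV: "J X \<in> ?V" and JJ: "J (J X) = vf_minus A X"
    and Jminus: "J (vf_minus A X) = vf_minus A (J X)" if "X \<in> ?V" for X
    using J that smooth_functions_const[of "-1" A]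
    by (auto simp: almost_complex_structure_def endomorphism_field_def vf_minus_def)
  note minusV = vector_fields_minus[OF J]
  note DV = linear_connection_closed[OF assms(2)]
  note Dminus = linear_connection_minus[OF assms(2)]
  have g_eq_iff: "(\<forall>Y\<in>?V. g Y U = g Y W) \<longleftrightarrow> U = W" if "U \<in> ?V" "W \<in> ?V" for U W
    using metric_eqI[OF A g that minusV] that by blast
  have "Dg = complex_conjugate A J D \<longleftrightarrow> parallel_form A D (associated_metric J g)"
    if Dg: "metric_conjugate A g D Dg" for Dg
  proof -
    have lin: "linear_connection A Dg"
      using Dg by (simp add: metric_conjugate_def)
    note DgV = linear_connection_closed[OF lin]
    \<comment> \<open>Conjugacy is used at the arguments \<open>Y\<close> and \<open>J Z\<close>.
      The quantifier over \<open>Y\<close> is put innermost to suit \<open>g_eq_iff\<close>.\<close>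
    have "parallel_form A D (associated_metric J g) \<longleftrightarrow>
        (\<forall>X\<in>?V. \<forall>Z\<in>?V. \<forall>Y\<in>?V. g Y (Dg X (J Z)) = g Y (J (D X Z)))"
      by (auto simp: parallel_form_iff associated_metric_def metric_conjugateD[OF Dg] JV fun_eq_iff)
    also have "\<dots> \<longleftrightarrow> (\<forall>X\<in>?V. \<forall>Z\<in>?V. Dg X (J Z) = J (D X Z))"
      by (simp add: g_eq_iff DgV JV DV)
    also have "\<dots> \<longleftrightarrow> (\<forall>X\<in>?V. \<forall>Z\<in>?V. Dg X Z = vf_minus A (J (D X (J Z))))" (is "?L \<longleftrightarrow> ?R")
    proof (intro iffI ballI)
      \<comment> \<open>Each direction instantiates its hypothesis at \<open>J Z\<close>; the
        resulting \<open>J (J Z)\<close> is the negative of \<open>Z\<close>, and the sign passes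
        through the connection.\<close>
      fix X Z assume ?L and XZ: "X \<in> ?V" "Z \<in> ?V"
      then have "Dg X (J (J Z)) = J (D X (J Z))"
        by (simp add: JV)
      then have "vf_minus A (Dg X Z) = J (D X (J Z))"
        using XZ by (simp add: JJ linear_connection_minus[OF lin])
      then show "Dg X Z = vf_minus A (J (D X (J Z)))"
        using XZ by (metis vf_minus_minus DgV)
    next
      fix X Z assume ?R and XZ: "X \<in> ?V" "Z \<in> ?V"
      then have "Dg X (J Z) = vf_minus A (J (D X (J (J Z))))"
        by (simp add: JV)
      then show "Dg X (J Z) = J (D X Z)"
        using XZ by (simp add: JJ Dminus Jminus vf_minus_minus JV DV)
    qed
    finally show ?thesis
      by (simp add: linear_connection_eq_complex_conjugate_iff[OF lin])
  qed
  moreover have "Dgt = complex_conjugate A J D \<longleftrightarrow> parallel_form A D g"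
    if Dgt: "metric_conjugate A (associated_metric J g) D Dgt" for Dgt
  proof -
    have lin: "linear_connection A Dgt"
      using Dgt by (simp add: metric_conjugate_def)
    note DgtV = linear_connection_closed[OF lin]
    \<comment> \<open>The witness is a preimage because the fourth power of \<open>J\<close> is the
      identity.\<close>
    have surj: "\<exists>Z\<in>?V. W = J Z" if "W \<in> ?V" for W
      using that by (intro bexI[of _ "J (J (J W))"]) (simp_all add: JJ JV Jminus minusV vf_minus_minus)
    \<comment> \<open>Surjectivity of \<open>J\<close> lets the last argument of \<open>g\<close>
      range over \<open>J Z\<close> only, which is where conjugacy relative to the associated metric
      speaks about \<open>g\<close>.\<close>
    have "parallel_form A D g \<longleftrightarrow> (\<forall>X\<in>?V. \<forall>Y\<in>?V. \<forall>Z\<in>?V.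
        X (g Y (J Z)) = (\<lambda>p. g (D X Y) (J Z) p + g Y (D X (J Z)) p))" (is "?L \<longleftrightarrow> ?R")
    proof
      assume R: ?R
      show ?L
        unfolding parallel_form_iff
      proof (intro ballI)
        fix X Y W assume XY: "X \<in> ?V" "Y \<in> ?V" and "W \<in> ?V"
        then obtain Z where "Z \<in> ?V" "W = J Z" using surj by blast
        then show "X (g Y W) = (\<lambda>p. g (D X Y) W p + g Y (D X W) p)"
          using R XY by simp
      qed
    qed (simp add: parallel_form_iff JV)
    also have "\<dots> \<longleftrightarrow> (\<forall>X\<in>?V. \<forall>Y\<in>?V. \<forall>Z\<in>?V. g Y (J (Dgt X Z)) = g Y (D X (J Z)))"
      by (intro ball_cong refl)
        (simp only: metric_conjugateD[OF Dgt, unfolded associated_metric_def]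
          fun_eq_iff add_left_cancel)
    also have "\<dots> \<longleftrightarrow> (\<forall>X\<in>?V. \<forall>Z\<in>?V. \<forall>Y\<in>?V. g Y (J (Dgt X Z)) = g Y (D X (J Z)))"
      by blast
    also have "\<dots> \<longleftrightarrow> (\<forall>X\<in>?V. \<forall>Z\<in>?V. J (Dgt X Z) = D X (J Z))"
      by (simp add: g_eq_iff DgtV JV DV)
    \<comment> \<open>Here the equivalence holds for each \<open>X\<close> and \<open>Z\<close>
      separately: apply \<open>J\<close> to either equation.\<close>
    also have "\<dots> \<longleftrightarrow> (\<forall>X\<in>?V. \<forall>Z\<in>?V. Dgt X Z = vf_minus A (J (D X (J Z))))"
      by (intro ball_cong refl) (metis JJ Jminus JV DV DgtV vf_minus_minus)
    finally show ?thesis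
      by (simp add: linear_connection_eq_complex_conjugate_iff[OF lin])
  qed
  ultimately show ?thesis by blast
qed

end
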